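(* For all integers $n\ge1$ and $s\ge0$, $k(s,n)\ge k_2(s,n)\ge k_1(s,n)$.
   Context: A tropical polynomial over $\mathbb{Q}$ in $\vec{x}=(x_1,\dots,x_n)$ is a finite collection of tropical monomials $m_J(\vec{x}) = c_J + j_1x_1+\dots+j_nx_n$ with pairwise distinct exponent vectors $J=(j_1,\dots,j_n)$ and constants $c_J\in\mathbb{Q}$; its value is $p(\vec{x})=\max_J m_J(\vec{x})$. Here the exponents are allowed to be arbitrary rational numbers. A polynomial is nontrivial if it has at least one monomial. A point $\vec{a}\in\mathbb{Q}^n$ is a root of $p$ if the maximum $\max_J m_J(\vec{a})$ is attained on at least two distinct monomials. $k(s,n)$ denotes the minimal number such that for any set $S$ of $s$ points in $\mathbb{Q}^n$ there is a nontrivial tropical polynomial over $\mathbb{Q}$ in $n$ variables with at most $k(s,n)$ monomials having roots in all the points of $S$. Bounded convex polyhedra in $n$-dimensional space are allowed to be degenerate (to have empty interior); boundary and interior are always taken in the ambient $n$-dimensional space. Two polyhedra $P$ and $Q$ are separated if there is a hyperplane $\pi$ such that $P$ and $Q$ lie in different closed halfspaces with respect to $\pi$. Given a finite set $S$ of points in $n$-dimensional space ($S\subseteq\mathbb{Q}^n$), a double covering (respectively single covering) of $S$ of size $k$ is a family $P_1,\dots,P_k$ of bounded convex polyhedra that are pairwise separated and such that each point of $S$ lies on the boundary of at least two (respectively at least one) of the polyhedra $P_i$. $k_2(s,n)$ (respectively $k_1(s,n)$) is the minimal number of polyhedra that is enough to double cover (respectively single cover) any $s$ points in $n$-dimensional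 space. *)

theory Defs
  imports "HOL-Analysis.Analysis"
begin

text \<open>
  Throughout, the dimension is \<open>n = CARD('n)\<close>; since types are nonempty, \<open>n \<ge> 1\<close>.
  The pair \<open>(c, J)\<close> stands for the tropical monomial \<open>c + j\<^sub>1 x\<^sub>1 + \<dots> + j\<^sub>n x\<^sub>n\<close>.
\<close>

type_synonym 'n trop_monomial = "rat \<times> (rat ^ 'n)"

definition monomial_value :: "'n::finite trop_monomial \<Rightarrow> rat ^ 'n \<Rightarrow> rat" where
  "monomial_value m x = fst m + (\<Sum>i\<in>UNIV. snd m $ i * x $ i)"

definition tropical_polynomial :: "'n::finite trop_monomial set \<Rightarrow> bool" where
  "tropical_polynomial p \<longleftrightarrow> finite p \<and> inj_on snd p"

definition trop_value :: "'n::finite trop_monomial set \<Rightarrow> rat ^ 'n \<Rightarrow> rat" where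
  "trop_value p x = Max ((\<lambda>m. monomial_value m x) ` p)"

definition trop_root :: "'n::finite trop_monomial set \<Rightarrow> rat ^ 'n \<Rightarrow> bool" where
  "trop_root p a \<longleftrightarrow>
     (\<exists>m\<in>p. \<exists>m'\<in>p. m \<noteq> m' \<and>
        monomial_value m a = trop_value p a \<and> monomial_value m' a = trop_value p a)"

definition k_trop :: "'n::finite itself \<Rightarrow> nat \<Rightarrow> nat" where
  "k_trop _ s = (LEAST k. \<forall>S :: (rat ^ 'n) set. finite S \<and> card S = s \<longrightarrow>
     (\<exists>p. tropical_polynomial p \<and> p \<noteq> {} \<and> card p \<le> k \<and> (\<forall>a\<in>S. trop_root p a)))"

definition real_point :: "rat ^ 'n::finite \<Rightarrow> real ^ 'n" where
  "real_point x = (\<chi> i. of_rat (x $ i))"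

definition hyperplane_separated :: "(real ^ 'n::finite) set \<Rightarrow> (real ^ 'n) set \<Rightarrow> bool" where
  "hyperplane_separated P Q \<longleftrightarrow>
     (\<exists>a b. a \<noteq> 0 \<and> P \<subseteq> {x. a \<bullet> x \<le> b} \<and> Q \<subseteq> {x. a \<bullet> x \<ge> b})"

text \<open>
  Coverings are indexed families, so multiplicities are counted by index. A degenerate polyhedron
  is separated from itself and may therefore occur several times. The empty polyhedron is
  admitted; it has empty boundary, so it only pads a family to a larger size.
\<close>

definition separated_family :: "nat \<Rightarrow> (nat \<Rightarrow> (real ^ 'n::finite) set) \<Rightarrow> bool" where
  "separated_family k P \<longleftrightarrow>
     (\<forall>i<k. polyhedron (P i) \<and> bounded (P i)) \<and>
     (\<forall>i<k. \<forall>j<k. i \<noteq> j \<longrightarrow> hyperplane_separated (P i) (P j))"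

definition double_covering ::
    "(rat ^ 'n::finite) set \<Rightarrow> nat \<Rightarrow> (nat \<Rightarrow> (real ^ 'n) set) \<Rightarrow> bool" where
  "double_covering S k P \<longleftrightarrow> separated_family k P \<and>
     (\<forall>x\<in>S. card {i. i < k \<and> real_point x \<in> frontier (P i)} \<ge> 2)"

definition single_covering ::
    "(rat ^ 'n::finite) set \<Rightarrow> nat \<Rightarrow> (nat \<Rightarrow> (real ^ 'n) set) \<Rightarrow> bool" where
  "single_covering S k P \<longleftrightarrow> separated_family k P \<and>
     (\<forall>x\<in>S. card {i. i < k \<and> real_point x \<in> frontier (P i)} \<ge> 1)"

definition k_double :: "'n::finite itself \<Rightarrow> nat \<Rightarrow> nat" where
  "k_double _ s = (LEAST k. \<forall>S :: (rat ^ 'n) set. finite S \<and> card S = s \<longrightarrow>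
     (\<exists>P. double_covering S k P))"

definition k_single :: "'n::finite itself \<Rightarrow> nat \<Rightarrow> nat" where
  "k_single _ s = (LEAST k. \<forall>S :: (rat ^ 'n) set. finite S \<and> card S = s \<longrightarrow>
     (\<exists>P. single_covering S k P))"

end

theory Submission
  imports Defs
begin

text \<open>
  A tropical polynomial is a maximum of affine functions, so each of its monomials has a cell: the
  convex region on which it attains the maximum. Two cells are separated by the hyperplane on which
  their monomials agree, which is a genuine hyperplane because the exponent vectors differ. At a
  root two monomials are maximal, so the root lies in two cells and, being on the separating
  hyperplane, in the interior of neither. Cutting the cells off by a box around \<open>S\<close> makes them
  bounded without losing the points of \<open>S\<close>. Hence a polynomial with roots on \<open>S\<close> gives a double
  covering with one polyhedron per monomial (\<open>double_covering_of_roots\<close>), and a double covering is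
  a single covering.

  The quantities compared are least elements, so they are only meaningful once some number is known
  to be admissible. By the two implications above it suffices to have a bound for tropical
  polynomials, and \<open>s + 1\<close> monomials are enough (\<open>exists_polynomial_with_roots\<close>): a convex
  piecewise linear function of a single coordinate can have its breakpoints at any \<open>s\<close> prescribed
  values of that coordinate.
\<close>

section \<open>Monomials as real affine functions\<close>

definition real_monomial_value :: "'n::finite trop_monomial \<Rightarrow> real ^ 'n \<Rightarrow> real" where
  "real_monomial_value m y = of_rat (fst m) + real_point (snd m) \<bullet> y"

lemma real_monomial_value_real_point:
  "real_monomial_value m (real_point x) = of_rat (monomial_value m x)"
  by (simp add: real_monomial_value_def monomial_value_def real_point_def inner_vec_def
      of_rat_add of_rat_sum of_rat_mult)

lemma real_point_eq_iff: "real_point x = real_point y \<longleftrightarrow> x = y"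
  by (simp add: real_point_def vec_eq_iff)

lemma real_monomial_value_le_iff:
  "real_monomial_value m' y \<le> real_monomial_value m y \<longleftrightarrow>
     (real_point (snd m') - real_point (snd m)) \<bullet> y \<le> of_rat (fst m) - of_rat (fst m')"
  by (auto simp: real_monomial_value_def inner_diff_left)

section \<open>Cells of a tropical polynomial\<close>

definition cell :: "'n::finite trop_monomial set \<Rightarrow> (real ^ 'n) set \<Rightarrow> 'n trop_monomial
    \<Rightarrow> (real ^ 'n) set" where
  "cell p B m = {y \<in> B. \<forall>m'\<in>p. real_monomial_value m' y \<le> real_monomial_value m y}"

lemma polyhedron_cell:
  assumes "finite p" "polyhedron B"
  shows "polyhedron (cell p B m)"
proof -
  have "cell p B m = B \<inter> \<Inter> ((\<lambda>m'. {y. (real_point (snd m') - real_point (snd m)) \<bullet> y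
      \<le> of_rat (fst m) - of_rat (fst m')}) ` p)"
    by (auto simp: cell_def real_monomial_value_le_iff)
  with assms show ?thesis
    by (auto intro!: polyhedron_Int polyhedron_Inter polyhedron_halfspace_le)
qed

lemma hyperplane_separated_cells:
  assumes "m \<in> p" "m' \<in> p" "snd m \<noteq> snd m'"
  shows "hyperplane_separated (cell p B m) (cell p B m')"
  unfolding hyperplane_separated_def
proof (intro exI conjI)
  let ?a = "real_point (snd m') - real_point (snd m)"
  let ?b = "of_rat (fst m) - of_rat (fst m')"
  show "?a \<noteq> 0"
    using assms by (simp add: real_point_eq_iff)
  show "cell p B m \<subseteq> {x. ?a \<bullet> x \<le> ?b}"
    using assms by (auto simp: cell_def real_monomial_value_le_iff)
  show "cell p B m' \<subseteq> {x. ?b \<le> ?a \<bullet> x}"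
    using assms by (auto simp: cell_def real_monomial_value_def inner_diff_left)
qed

text \<open>
  If another monomial with a different exponent vector is maximal at the same point, it overtakes
  in every neighbourhood: the cell lies in a halfspace whose boundary passes through the point.
\<close>

lemma in_frontier_cell:
  assumes "y \<in> cell p B m" "m' \<in> p" "snd m \<noteq> snd m'"
    and eq: "real_monomial_value m' y = real_monomial_value m y"
  shows "y \<in> frontier (cell p B m)"
proof -
  let ?a = "real_point (snd m') - real_point (snd m)"
  let ?b = "of_rat (fst m) - of_rat (fst m') :: real"
  have "?a \<noteq> 0"
    using assms by (simp add: real_point_eq_iff)
  moreover have "cell p B m \<subseteq> {x. ?a \<bullet> x \<le> ?b}"
    using assms by (auto simp: cell_def real_monomial_value_le_iff)
  ultimately have "interior (cell p B m) \<subseteq> {x. ?a \<bullet> x < ?b}"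
    using interior_mono interior_halfspace_le by metis
  moreover have "?a \<bullet> y = ?b"
    using eq by (simp add: real_monomial_value_def inner_diff_left)
  ultimately have "y \<notin> interior (cell p B m)"
    by auto
  with assms(1) show ?thesis
    using closure_subset by (auto simp: frontier_def)
qed

lemma trop_root_in_two_frontiers:
  assumes p: "tropical_polynomial p" and root: "trop_root p x" and B: "real_point x \<in> B"
  obtains m m' where "m \<in> p" "m' \<in> p" "m \<noteq> m'"
    "real_point x \<in> frontier (cell p B m)" "real_point x \<in> frontier (cell p B m')"
proof -
  obtain m m' where m: "m \<in> p" "m' \<in> p" "m \<noteq> m'"
    and max: "monomial_value m x = trop_value p x" "monomial_value m' x = trop_value p x"
    using root by (auto simp: trop_root_def)
  have "snd m \<noteq> snd m'"
    using p m by (auto simp: tropical_polynomial_def inj_on_def)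
  have le: "monomial_value l x \<le> trop_value p x" if "l \<in> p" for l
    using p that by (auto simp: trop_value_def tropical_polynomial_def)
  have eq: "real_monomial_value m (real_point x) = real_monomial_value m' (real_point x)"
    using max by (simp add: real_monomial_value_real_point)
  have "real_point x \<in> cell p B m" "real_point x \<in> cell p B m'"
    using le max B by (auto simp: cell_def real_monomial_value_real_point of_rat_less_eq)
  with \<open>snd m \<noteq> snd m'\<close> m eq that show thesis
    by (metis in_frontier_cell)
qed

section \<open>From roots to double coverings\<close>

lemma hyperplane_separated_commute:
  assumes "hyperplane_separated P Q"
  shows "hyperplane_separated Q P"
proof -
  obtain a b where "a \<noteq> 0" "P \<subseteq> {x. a \<bullet> x \<le> b}" "Q \<subseteq> {x. a \<bullet> x \<ge> b}"
    using assms by (auto simp: hyperplane_separated_def)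
  then have "- a \<noteq> 0" "Q \<subseteq> {x. - a \<bullet> x \<le> - b}" "P \<subseteq> {x. - a \<bullet> x \<ge> - b}"
    by auto
  then show ?thesis
    unfolding hyperplane_separated_def by blast
qed

lemma hyperplane_separated_empty:
  fixes P :: "(real ^ 'n::finite) set"
  assumes "bounded P"
  shows "hyperplane_separated P {}"
proof -
  obtain r where r: "\<And>x. x \<in> P \<Longrightarrow> norm x \<le> r"
    using assms by (auto simp: bounded_iff)
  fix i :: 'n
  have "axis i 1 \<bullet> x \<le> r" if "x \<in> P" for x
    using r[OF that] component_le_norm_cart[of x i] by (simp add: inner_axis')
  moreover have "axis i (1::real) \<noteq> 0"
    by (simp add: axis_eq_0_iff)
  ultimately show ?thesis
    unfolding hyperplane_separated_def by blast
qed

text \<open>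
  The family is indexed by exactly \<open>k\<close> numbers although \<open>p\<close> may have fewer monomials; the remaining
  indices carry the empty polyhedron.
\<close>

lemma double_covering_of_roots:
  fixes S :: "(rat ^ 'n::finite) set"
  assumes S: "finite S" and p: "tropical_polynomial p" "card p \<le> k"
    and roots: "\<forall>x\<in>S. trop_root p x"
  shows "\<exists>P. double_covering S k P"
proof -
  have fin: "finite p" and inj: "inj_on snd p"
    using p by (auto simp: tropical_polynomial_def)
  have "bounded (real_point ` S)"
    using S by (simp add: finite_imp_bounded)
  then obtain l u where box: "real_point ` S \<subseteq> cbox l u"
    using bounded_subset_cbox_symmetric by metis
  define B where "B = cbox l u"
  obtain e where e: "bij_betw e {..<card p} p"
    using ex_bij_betw_nat_finite[OF fin] by (auto simp: atLeast0LessThan)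
  define P where "P = (\<lambda>i. if i < card p then cell p B (e i) else {})"
  have polyhedral: "polyhedron (P i)" for i
    using fin by (simp add: P_def B_def polyhedron_cell polytope_interval polytope_imp_polyhedron)
  have "P i \<subseteq> B" for i
    by (auto simp: P_def cell_def)
  then have bounded: "bounded (P i)" for i
    unfolding B_def using bounded_cbox bounded_subset by blast
  have separated: "hyperplane_separated (P i) (P j)" if "i \<noteq> j" for i j
  proof (cases "i < card p \<and> j < card p")
    case True
    then have "e i \<in> p" "e j \<in> p" "e i \<noteq> e j"
      using e that by (auto simp: bij_betw_def inj_on_def)
    then show ?thesis
      using True inj by (auto simp: P_def inj_on_def intro!: hyperplane_separated_cells)
  next
    case False
    then have "P i = {} \<or> P j = {}"
      by (auto simp: P_def)
    then show ?thesis
      using bounded hyperplane_separated_empty hyperplane_separated_commute by metis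
  qed
  have "2 \<le> card {i. i < k \<and> real_point x \<in> frontier (P i)}" if x: "x \<in> S" for x
  proof -
    have "trop_root p x" "real_point x \<in> B"
      using roots box x by (auto simp: B_def)
    then obtain m m' where m: "m \<in> p" "m' \<in> p" "m \<noteq> m'"
      and front: "real_point x \<in> frontier (cell p B m)" "real_point x \<in> frontier (cell p B m')"
      by (rule trop_root_in_two_frontiers[OF p(1)])
    have "m \<in> e ` {..<card p}" "m' \<in> e ` {..<card p}"
      using m by (simp_all add: bij_betw_imp_surj_on[OF e])
    then obtain i j where ij: "i < card p" "m = e i" "j < card p" "m' = e j"
      by blast
    with m front p(2) have "{i, j} \<subseteq> {i. i < k \<and> real_point x \<in> frontier (P i)}" "i \<noteq> j"
      by (auto simp: P_def)
    then show ?thesis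
      using card_mono[of "{i. i < k \<and> real_point x \<in> frontier (P i)}" "{i, j}"] by simp
  qed
  with polyhedral bounded separated have "double_covering S k P"
    by (simp add: double_covering_def separated_family_def)
  then show ?thesis
    by (intro exI[of _ P])
qed

section \<open>Polynomials with prescribed roots\<close>

text \<open>
  For a nondecreasing \<open>t\<close>, the function \<open>j \<mapsto> j x - (t\<^sub>0 + \<dots> + t\<^bsub>j - 1\<^esub>)\<close> is concave in
  \<open>j\<close>: its increments \<open>x - t\<^sub>j\<close> do not increase. For \<open>x = t\<^sub>i\<close> the increment from \<open>i\<close> to \<open>i + 1\<close>
  vanishes, so the maximum is attained at both.
\<close>

lemma sorted_partial_sum_max:
  fixes t :: "nat \<Rightarrow> 'a::linordered_idom"
  assumes mono: "\<And>a b. a \<le> b \<Longrightarrow> b < N \<Longrightarrow> t a \<le> t b" and "i < N" "j \<le> N"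
  shows "of_nat j * t i - sum t {..<j} \<le> of_nat i * t i - sum t {..<i}"
proof -
  have increments: "of_nat k * t i - sum t {..<k} = (\<Sum>l<k. t i - t l)" for k
    by (simp add: sum_subtractf)
  show ?thesis
  proof (cases "j \<le> i")
    case True
    have "(\<Sum>l<j. t i - t l) \<le> (\<Sum>l<i. t i - t l)"
      using True \<open>i < N\<close> by (intro sum_mono2) (auto intro!: mono)
    then show ?thesis
      by (simp only: increments)
  next
    case False
    then have "{..<j} = {..<i} \<union> {i..<j}"
      by auto
    then have "(\<Sum>l<j. t i - t l) = (\<Sum>l<i. t i - t l) + (\<Sum>l=i..<j. t i - t l)"
      by (simp add: sum.union_disjoint ivl_disj_int)
    moreover have "(\<Sum>l=i..<j. t i - t l) \<le> 0"
      using \<open>j \<le> N\<close> by (intro sum_nonpos) (auto intro!: mono)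
    ultimately show ?thesis
      by (simp only: increments)
  qed
qed

text \<open>
  The monomials are \<open>j x\<^sub>d - (t\<^sub>0 + \<dots> + t\<^bsub>j - 1\<^esub>)\<close> for one fixed coordinate \<open>d\<close>, where the
  \<open>t\<^sub>i\<close> are the sorted values of this coordinate on \<open>S\<close>. Points of \<open>S\<close> may share a value, which
  only makes the list shorter.
\<close>

lemma exists_polynomial_with_roots:
  fixes S :: "(rat ^ 'n::finite) set"
  assumes "finite S"
  obtains p where "tropical_polynomial p" "p \<noteq> {}" "card p \<le> Suc (card S)"
    "\<forall>x\<in>S. trop_root p x"
proof -
  fix d :: 'n
  define ts where "ts = sorted_list_of_set ((\<lambda>x. x $ d) ` S)"
  define t where "t = (\<lambda>i. ts ! i)"
  define mon :: "nat \<Rightarrow> 'n trop_monomial" where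
    "mon = (\<lambda>j. (- sum t {..<j}, axis d (of_nat j)))"
  define p where "p = mon ` {..length ts}"
  have set_ts: "set ts = (\<lambda>x. x $ d) ` S"
    using assms by (simp add: ts_def)
  have len: "length ts \<le> card S"
    using assms by (simp add: ts_def card_image_le)
  have val: "monomial_value (mon j) x = of_nat j * x $ d - sum t {..<j}" for j x
  proof -
    have "(\<Sum>i\<in>UNIV. axis d (of_nat j) $ i * x $ i) =
        (\<Sum>i\<in>UNIV. if i = d then of_nat j * x $ d else 0)"
      by (rule sum.cong) (auto simp: axis_def)
    then show ?thesis
      by (simp add: monomial_value_def mon_def)
  qed
  have "inj_on snd p"
    by (auto simp: p_def inj_on_def mon_def axis_eq_axis)
  then have poly: "tropical_polynomial p"
    by (simp add: tropical_polynomial_def p_def)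
  have "card p \<le> Suc (card S)"
    using card_image_le[of "{..length ts}" mon] len by (simp add: p_def)
  moreover have "trop_root p x" if "x \<in> S" for x
  proof -
    have "x $ d \<in> set ts"
      using that set_ts by blast
    then obtain i where i: "i < length ts" "t i = x $ d"
      by (auto simp: in_set_conv_nth t_def)
    have "sorted ts"
      by (simp add: ts_def)
    then have "t a \<le> t b" if "a \<le> b" "b < length ts" for a b
      using that by (simp add: t_def sorted_nth_mono)
    then have "monomial_value (mon j) x \<le> monomial_value (mon i) x" if "j \<le> length ts" for j
      using sorted_partial_sum_max[of "length ts" t i j] i that by (simp add: val)
    then have "\<forall>v\<in>(\<lambda>m. monomial_value m x) ` p. v \<le> monomial_value (mon i) x"
      unfolding p_def by blast
    moreover have "finite p" "mon i \<in> p"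
      using i(1) unfolding p_def by simp_all
    ultimately have max: "trop_value p x = monomial_value (mon i) x"
      unfolding trop_value_def by (intro Max_eqI finite_imageI imageI) blast+
    have "monomial_value (mon (Suc i)) x = monomial_value (mon i) x"
      by (simp add: val distrib_right flip: i(2))
    moreover have "mon i \<noteq> mon (Suc i)"
      by (simp add: mon_def axis_eq_axis)
    moreover have "mon i \<in> p" "mon (Suc i) \<in> p"
      using i(1) unfolding p_def by simp_all
    ultimately show ?thesis
      unfolding trop_root_def using max by metis
  qed
  ultimately show thesis
    using that poly by (auto simp: p_def)
qed

section \<open>Comparing the minimal sizes\<close>

lemma single_covering_of_double_covering: "double_covering S k P \<Longrightarrow> single_covering S k P"
  by (fastforce simp: double_covering_def single_covering_def)

theorem theorem14:
  fixes s :: nat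
  shows "k_trop TYPE('n::finite) s \<ge> k_double TYPE('n) s \<and>
         k_double TYPE('n) s \<ge> k_single TYPE('n) s"
proof -
  define trop where "trop = (\<lambda>k. \<forall>S :: (rat ^ 'n) set. finite S \<and> card S = s \<longrightarrow>
     (\<exists>p. tropical_polynomial p \<and> p \<noteq> {} \<and> card p \<le> k \<and> (\<forall>a\<in>S. trop_root p a)))"
  define double where "double = (\<lambda>k. \<forall>S :: (rat ^ 'n) set. finite S \<and> card S = s \<longrightarrow>
     (\<exists>P. double_covering S k P))"
  define single where "single = (\<lambda>k. \<forall>S :: (rat ^ 'n) set. finite S \<and> card S = s \<longrightarrow>
     (\<exists>P. single_covering S k P))"
  have k: "k_trop TYPE('n) s = Least trop" "k_double TYPE('n) s = Least double"
    "k_single TYPE('n) s = Least single"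
    by (simp_all add: k_trop_def k_double_def k_single_def trop_def double_def single_def)
  have "trop (Suc s)"
    unfolding trop_def by (metis exists_polynomial_with_roots)
  then have "trop (Least trop)"
    by (rule LeastI)
  then have "double (Least trop)"
    unfolding trop_def double_def using double_covering_of_roots by blast
  then have "Least double \<le> Least trop" "double (Least double)"
    by (auto intro: Least_le LeastI)
  moreover from this have "single (Least double)"
    unfolding double_def single_def using single_covering_of_double_covering by blast
  then have "Least single \<le> Least double"
    by (rule Least_le)
  ultimately show ?thesis
    by (simp add: k)
qed

end
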